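(* Let $c\neq 0$ and $\lambda>0$ be real constants, let $I\subset\mathbb{R}$ be an open interval on which $\cos\left(\frac{u}{c}\right)\neq0$ and $1-\frac{\lambda^2}{c^2}\sin^2\left(\frac{u}{c}\right)>0$, and let $\rho=\rho(v)$ be a smooth curve parametrized by arclength on the unit sphere $S^2$ of the subspace $\mathbb{E}^3=\mathrm{span}\{e_2,e_3,e_4\}$ of $\mathbb{E}^4$. Then the generalized spherical surface of second kind in $\mathbb{E}^4$ determined by $c,\lambda,\rho$ has constant Gaussian curvature $K=1/c^2$.
   Context: Let $e_1,\dots,e_4$ be the standard orthonormal basis of $\mathbb{E}^4$. The generalized spherical surface of second kind determined by $c,\lambda,\rho$ is the surface in $\mathbb{E}^4$ given by $$X(u,v)=\phi(u)\,e_1+\lambda\cos\left(\tfrac uc\right)\rho(v),\qquad \phi(u)=\int\sqrt{1-\tfrac{\lambda^2}{c^2}\sin^2\left(\tfrac uc\right)}\,du,\qquad u\in I$$ (any antiderivative). For a regular patch in $\mathbb{E}^4$ with $g_{11}=\langle X_u,X_u\rangle$, $g_{12}=\langle X_u,X_v\rangle$, $g_{22}=\langle X_v,X_v\rangle$, $W^2=g_{11}g_{22}-g_{12}^2\neq0$, orthonormal normal frame $N_1,N_2$ and $L_{11}^k=\langle X_{uu},N_k\rangle$, $L_{12}^k=\langle X_{uv},N_k\rangle$, $L_{22}^k=\langle X_{vv},N_k\rangle$, the Gaussian curvature is $K=\frac{1}{W^2}\sum_{k=1}^{2}\left(L_{11}^kL_{22}^k-(L_{12}^k)^2\right)$. 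*)

theory Defs
  imports "HOL-Analysis.Analysis"
begin

text \<open>Curves and surface patches are total functions; all hypotheses are imposed on open
  parameter domains, so derivatives are two-sided.\<close>

definition smooth_curve_on :: "real set \<Rightarrow> (real \<Rightarrow> real ^ 4) \<Rightarrow> bool" where
  "smooth_curve_on J \<gamma> \<longleftrightarrow>
     (\<forall>n. \<forall>t\<in>J. ((\<lambda>g s. vector_derivative g (at s)) ^^ n) \<gamma> differentiable at t)"

definition unit_speed_on :: "real set \<Rightarrow> (real \<Rightarrow> real ^ 4) \<Rightarrow> bool" where
  "unit_speed_on J \<gamma> \<longleftrightarrow> (\<forall>t\<in>J. norm (vector_derivative \<gamma> (at t)) = 1)"

type_synonym patch = "real \<Rightarrow> real \<Rightarrow> real ^ 4"

definition D_u :: "patch \<Rightarrow> patch" where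
  "D_u X u v = vector_derivative (\<lambda>s. X s v) (at u)"

definition D_v :: "patch \<Rightarrow> patch" where
  "D_v X u v = vector_derivative (\<lambda>t. X u t) (at v)"

definition g11 :: "patch \<Rightarrow> real \<Rightarrow> real \<Rightarrow> real" where
  "g11 X u v = D_u X u v \<bullet> D_u X u v"

definition g12 :: "patch \<Rightarrow> real \<Rightarrow> real \<Rightarrow> real" where
  "g12 X u v = D_u X u v \<bullet> D_v X u v"

definition g22 :: "patch \<Rightarrow> real \<Rightarrow> real \<Rightarrow> real" where
  "g22 X u v = D_v X u v \<bullet> D_v X u v"

definition W_squared :: "patch \<Rightarrow> real \<Rightarrow> real \<Rightarrow> real" where
  "W_squared X u v = g11 X u v * g22 X u v - (g12 X u v)\<^sup>2"

definition orthonormal_normal_frame ::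
  "patch \<Rightarrow> real \<Rightarrow> real \<Rightarrow> real ^ 4 \<Rightarrow> real ^ 4 \<Rightarrow> bool" where
  "orthonormal_normal_frame X u v N1 N2 \<longleftrightarrow>
     norm N1 = 1 \<and> norm N2 = 1 \<and> N1 \<bullet> N2 = 0 \<and>
     (\<forall>N\<in>{N1, N2}. N \<bullet> D_u X u v = 0 \<and> N \<bullet> D_v X u v = 0)"

definition L11 :: "patch \<Rightarrow> real \<Rightarrow> real \<Rightarrow> real ^ 4 \<Rightarrow> real" where
  "L11 X u v N = D_u (D_u X) u v \<bullet> N"

text \<open>\<open>X\<^sub>u\<^sub>v\<close> is read as \<open>(X\<^sub>u)\<^sub>v\<close>.\<close>

definition L12 :: "patch \<Rightarrow> real \<Rightarrow> real \<Rightarrow> real ^ 4 \<Rightarrow> real" where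
  "L12 X u v N = D_v (D_u X) u v \<bullet> N"

definition L22 :: "patch \<Rightarrow> real \<Rightarrow> real \<Rightarrow> real ^ 4 \<Rightarrow> real" where
  "L22 X u v N = D_v (D_v X) u v \<bullet> N"

text \<open>\<open>N1\<close> and \<open>N2\<close> are the values at \<open>(u, v)\<close> of a normal frame; the formula
  involves no derivatives of the frame.\<close>

definition gaussian_curvature ::
  "patch \<Rightarrow> real \<Rightarrow> real \<Rightarrow> real ^ 4 \<Rightarrow> real ^ 4 \<Rightarrow> real" where
  "gaussian_curvature X u v N1 N2 =
     ((L11 X u v N1 * L22 X u v N1 - (L12 X u v N1)\<^sup>2) +
      (L11 X u v N2 * L22 X u v N2 - (L12 X u v N2)\<^sup>2)) / W_squared X u v"

lemma orthonormal_normal_frame_exists: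
  "\<exists>N1 N2. orthonormal_normal_frame X u v N1 N2"
proof -
  let ?a = "D_u X u v" and ?b = "D_v X u v"
  have "dim {?a, ?b} \<le> card {?a, ?b}" by (intro dim_le_card') auto
  also have "\<dots> \<le> 2" by (simp add: card_insert_if)
  finally have "dim {?a, ?b} < DIM(real ^ 4)" by simp
  then obtain x where x: "x \<noteq> 0" "\<And>y. y \<in> span {?a, ?b} \<Longrightarrow> orthogonal x y"
    using orthogonal_to_subspace_exists by blast
  have "dim {x, ?a, ?b} \<le> card {x, ?a, ?b}" by (intro dim_le_card') auto
  also have "\<dots> \<le> 3" by (simp add: card_insert_if)
  finally have "dim {x, ?a, ?b} < DIM(real ^ 4)" by simp
  then obtain y where y: "y \<noteq> 0" "\<And>z. z \<in> span {x, ?a, ?b} \<Longrightarrow> orthogonal y z"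
    using orthogonal_to_subspace_exists by blast
  have "x \<bullet> ?a = 0" "x \<bullet> ?b = 0" "y \<bullet> x = 0" "y \<bullet> ?a = 0" "y \<bullet> ?b = 0"
    using x(2) y(2) by (auto simp: orthogonal_def span_base)
  then have "orthonormal_normal_frame X u v (sgn x) (sgn y)"
    using x(1) y(1)
    by (auto simp: orthonormal_normal_frame_def norm_sgn sgn_div_norm inner_commute)
  then show ?thesis by blast
qed

text \<open>The coordinate vectors of \<open>real ^ 4\<close> are \<open>axis 1 1, \<dots>, axis 4 1\<close>.\<close>

definition generalized_spherical_surface_2 ::
  "real \<Rightarrow> real \<Rightarrow> (real \<Rightarrow> real) \<Rightarrow> (real \<Rightarrow> real ^ 4) \<Rightarrow> patch" where
  "generalized_spherical_surface_2 c l \<phi> \<rho> =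
     (\<lambda>u v. \<phi> u *\<^sub>R axis 1 1 + (l * cos (u / c)) *\<^sub>R \<rho> v)"

end

theory Submission
  imports Defs
begin

text \<open>
  The surface is a rotational surface: the plane curve with coordinates \<open>\<phi> u\<close> along the axis
  \<open>axis 1 1\<close> and \<open>f u = l * cos (u / c)\<close> across it is swept along the spherical curve \<open>\<rho>\<close>.
  The integrand defining \<open>\<phi>\<close> is chosen so that this profile curve has unit speed. Hence the induced
  metric is \<open>du\<^sup>2 + f\<^sup>2 dv\<^sup>2\<close>, whose curvature is \<open>- f'' / f\<close>, and \<open>f'' = - f / c\<^sup>2\<close> for the cosine.

  The curvature is computed extrinsically. Three observations make this short. First,
  \<open>X\<^sub>u\<^sub>v\<close> is tangent to the surface, so the mixed coefficients of the second fundamental form vanish.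
  Secondly, the profile curve has unit speed, so \<open>X\<^sub>u\<^sub>u\<close> is orthogonal to \<open>X\<^sub>u\<close>; it is also
  orthogonal to \<open>X\<^sub>v\<close>, thus purely normal. By Parseval's identity
  (\<open>inner_normal_components\<close>) the sum of \<open>\<langle>X\<^sub>u\<^sub>u, N\<^sub>k\<rangle> \<langle>X\<^sub>v\<^sub>v, N\<^sub>k\<rangle>\<close> is then just the inner product
  \<open>\<langle>X\<^sub>u\<^sub>u, X\<^sub>v\<^sub>v\<rangle>\<close>, and no explicit normal frame is needed. Thirdly, differentiating
  \<open>\<langle>\<rho>, \<rho>\<rangle> = 1\<close> twice gives \<open>\<langle>\<rho>, \<rho>''\<rangle> = - 1\<close> because \<open>\<rho>\<close> has unit speed, so this inner product is \<open>- f * f''\<close>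
  (\<open>rotational_patch_curvature\<close>).
\<close>

text \<open>
  Parseval's identity for the frame \<open>E1, E2, N1, N2\<close>; the tangential terms drop out because
  one of the two vectors is normal. It replaces the choice of a concrete normal frame.
\<close>

lemma inner_normal_components:
  fixes E1 E2 N1 N2 a b :: "real ^ 4"
  assumes norms: "norm E1 = 1" "norm E2 = 1" "norm N1 = 1" "norm N2 = 1"
    and orth: "E1 \<bullet> E2 = 0" "E1 \<bullet> N1 = 0" "E1 \<bullet> N2 = 0" "E2 \<bullet> N1 = 0" "E2 \<bullet> N2 = 0" "N1 \<bullet> N2 = 0"
    and normal: "a \<bullet> E1 = 0" "a \<bullet> E2 = 0"
  shows "(a \<bullet> N1) * (b \<bullet> N1) + (a \<bullet> N2) * (b \<bullet> N2) = a \<bullet> b"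
proof -
  let ?B = "{E1, E2, N1, N2}"
  have self: "x \<bullet> x = 1" if "x \<in> ?B" for x
    using that norms by (auto simp: dot_square_norm)
  have ne: "E1 \<noteq> E2" "E1 \<noteq> N1" "E1 \<noteq> N2" "E2 \<noteq> N1" "E2 \<noteq> N2" "N1 \<noteq> N2"
    using self orth by force+
  have pw: "pairwise orthogonal ?B"
    using orth by (auto simp: pairwise_def orthogonal_def inner_commute)
  moreover have "0 \<notin> ?B"
    using norms by auto
  ultimately have "independent ?B"
    by (rule pairwise_orthogonal_independent)
  moreover have "card ?B = 4"
    using ne by simp
  ultimately have "UNIV \<subseteq> span ?B"
    by (intro card_ge_dim_independent) auto
  then have "a = (\<Sum>v\<in>?B. (a \<bullet> v) *\<^sub>R v)"
    using pw norms by (intro orthonormal_basis_expand[symmetric]) auto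
  also have "\<dots> = (a \<bullet> N1) *\<^sub>R N1 + (a \<bullet> N2) *\<^sub>R N2"
    using ne normal by simp
  finally have "a \<bullet> b = ((a \<bullet> N1) *\<^sub>R N1 + (a \<bullet> N2) *\<^sub>R N2) \<bullet> b"
    by (rule arg_cong)
  also have "\<dots> = (a \<bullet> N1) * (b \<bullet> N1) + (a \<bullet> N2) * (b \<bullet> N2)"
    by (simp add: inner_add_left inner_commute[of b])
  finally show ?thesis ..
qed

lemma has_vector_derivative_inner_constant:
  fixes f g :: "real \<Rightarrow> 'a :: real_inner"
  assumes "open S" "t \<in> S" "\<And>s. s \<in> S \<Longrightarrow> f s \<bullet> g s = k"
    and "(f has_vector_derivative f') (at t)" "(g has_vector_derivative g') (at t)"
  shows "f t \<bullet> g' + f' \<bullet> g t = 0"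
proof -
  have "((\<lambda>s. f s \<bullet> g s) has_vector_derivative f t \<bullet> g' + f' \<bullet> g t) (at t)"
    using assms(4,5) by (rule bounded_bilinear.has_vector_derivative[OF bounded_bilinear_inner])
  then have "((\<lambda>s. k) has_vector_derivative f t \<bullet> g' + f' \<bullet> g t) (at t)"
    by (rule has_vector_derivative_transform_within_open[OF _ assms(1-3)])
  from vector_derivative_unique_at[OF this has_vector_derivative_const] show ?thesis .
qed

lemma has_vector_derivative_linear_combination:
  fixes x y :: "'a :: real_normed_vector"
  assumes "(a has_real_derivative a') (at t)" "(b has_real_derivative b') (at t)"
  shows "((\<lambda>s. a s *\<^sub>R x + b s *\<^sub>R y) has_vector_derivative a' *\<^sub>R x + b' *\<^sub>R y) (at t)"
  using has_vector_derivative_add[OF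
      has_vector_derivative_scaleR[OF assms(1) has_vector_derivative_const]
      has_vector_derivative_scaleR[OF assms(2) has_vector_derivative_const]]
  by simp

lemma has_vector_derivative_affine:
  fixes x :: "'a :: real_normed_vector"
  assumes "(g has_vector_derivative g') (at t)"
  shows "((\<lambda>s. x + k *\<^sub>R g s) has_vector_derivative k *\<^sub>R g') (at t)"
  using has_vector_derivative_add[OF has_vector_derivative_const
      bounded_linear.has_vector_derivative[OF bounded_linear_scaleR_right assms]]
  by simp

text \<open>
  The product \<open>f u *\<^sub>R \<rho> v\<close> rotates the unit-speed profile \<open>(\<phi>, f)\<close> around the axis \<open>e\<close>. As for
  a surface of revolution in 3-space, only the distance \<open>f\<close> to the axis enters
  the curvature; the geodesic curvature of \<open>\<rho>\<close> in the sphere drops out because only the component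
  of \<open>\<rho>''\<close> along \<open>\<rho>\<close> meets \<open>X\<^sub>u\<^sub>u\<close>.
\<close>

lemma rotational_patch_curvature:
  fixes e :: "real ^ 4" and \<rho> \<rho>1 \<rho>2 :: "real \<Rightarrow> real ^ 4"
    and \<phi> p q f f1 f2 :: "real \<Rightarrow> real"
  defines "X \<equiv> \<lambda>u v. \<phi> u *\<^sub>R e + f u *\<^sub>R \<rho> v"
  assumes S: "open I" "open J" "u \<in> I" "v \<in> J"
    and \<phi>: "\<And>s. s \<in> I \<Longrightarrow> (\<phi> has_real_derivative p s) (at s)"
      "\<And>s. s \<in> I \<Longrightarrow> (p has_real_derivative q s) (at s)"
    and f: "\<And>s. s \<in> I \<Longrightarrow> (f has_real_derivative f1 s) (at s)"
      "\<And>s. s \<in> I \<Longrightarrow> (f1 has_real_derivative f2 s) (at s)"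
    and speed: "\<And>s. s \<in> I \<Longrightarrow> (p s)\<^sup>2 + (f1 s)\<^sup>2 = 1" and f_nz: "f u \<noteq> 0"
    and e: "norm e = 1" and e\<rho>: "\<And>t. t \<in> J \<Longrightarrow> e \<bullet> \<rho> t = 0"
    and \<rho>: "\<And>t. t \<in> J \<Longrightarrow> (\<rho> has_vector_derivative \<rho>1 t) (at t)"
      "\<And>t. t \<in> J \<Longrightarrow> (\<rho>1 has_vector_derivative \<rho>2 t) (at t)"
    and sph: "\<And>t. t \<in> J \<Longrightarrow> norm (\<rho> t) = 1" and unit: "\<And>t. t \<in> J \<Longrightarrow> norm (\<rho>1 t) = 1"
  shows "W_squared X u v = (f u)\<^sup>2"
    and "orthonormal_normal_frame X u v N1 N2 \<Longrightarrow> gaussian_curvature X u v N1 N2 = - f2 u / f u"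
proof -
  have Du: "D_u X s t = p s *\<^sub>R e + f1 s *\<^sub>R \<rho> t" if "s \<in> I" for s t
    unfolding D_u_def X_def using \<phi>(1)[OF that] f(1)[OF that]
    by (intro vector_derivative_at has_vector_derivative_linear_combination)
  have Dv: "D_v X s t = f s *\<^sub>R \<rho>1 t" if "t \<in> J" for s t
    unfolding D_v_def X_def using \<rho>(1)[OF that]
    by (intro vector_derivative_at has_vector_derivative_affine)
  have "((\<lambda>s. D_u X s v) has_vector_derivative q u *\<^sub>R e + f2 u *\<^sub>R \<rho> v) (at u)"
    using has_vector_derivative_linear_combination[OF \<phi>(2)[OF S(3)] f(2)[OF S(3)]]
    by (rule has_vector_derivative_transform_within_open[OF _ S(1,3)]) (rule Du[symmetric])
  then have Duu: "D_u (D_u X) u v = q u *\<^sub>R e + f2 u *\<^sub>R \<rho> v"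
    unfolding D_u_def[of "D_u X"] by (rule vector_derivative_at)
  have Duv: "D_v (D_u X) u v = f1 u *\<^sub>R \<rho>1 v"
    unfolding D_v_def Du[OF S(3)] using \<rho>(1)[OF S(4)]
    by (intro vector_derivative_at has_vector_derivative_affine)
  have "((\<lambda>t. D_v X u t) has_vector_derivative f u *\<^sub>R \<rho>2 v) (at v)"
    using has_vector_derivative_affine[OF \<rho>(2)[OF S(4)], of 0 "f u"]
    by (rule has_vector_derivative_transform_within_open[OF _ S(2,4)]) (simp add: Dv)
  then have Dvv: "D_v (D_v X) u v = f u *\<^sub>R \<rho>2 v"
    unfolding D_v_def[of "D_v X"] by (rule vector_derivative_at)

  have \<rho>\<rho>: "\<rho> t \<bullet> \<rho> t = 1" and \<rho>1\<rho>1: "\<rho>1 t \<bullet> \<rho>1 t = 1" if "t \<in> J" for t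
    using sph[OF that] unit[OF that] by (simp_all add: dot_square_norm)
  have \<rho>\<rho>1: "\<rho> t \<bullet> \<rho>1 t = 0" if "t \<in> J" for t
    using has_vector_derivative_inner_constant[OF S(2) that \<rho>\<rho> \<rho>(1)[OF that] \<rho>(1)[OF that]]
    by (simp add: inner_commute)
  have \<rho>\<rho>2: "\<rho> v \<bullet> \<rho>2 v = - 1"
    using has_vector_derivative_inner_constant[OF S(2,4) \<rho>\<rho>1 \<rho>(1)[OF S(4)] \<rho>(2)[OF S(4)]] \<rho>1\<rho>1[OF S(4)]
    by simp
  have e\<rho>1: "e \<bullet> \<rho>1 t = 0" if "t \<in> J" for t
    using has_vector_derivative_inner_constant[OF S(2) that e\<rho> has_vector_derivative_const \<rho>(1)[OF that]]
    by simp
  have e\<rho>2: "e \<bullet> \<rho>2 v = 0"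
    using has_vector_derivative_inner_constant[OF S(2,4) e\<rho>1 has_vector_derivative_const \<rho>(2)[OF S(4)]]
    by simp
  have "p u * q u + q u * p u + (f1 u * f2 u + f2 u * f1 u) = 0"
  proof -
    have "((\<lambda>s. (p s)\<^sup>2 + (f1 s)\<^sup>2) has_real_derivative
        p u * q u + q u * p u + (f1 u * f2 u + f2 u * f1 u)) (at u)"
      by (auto intro!: derivative_eq_intros \<phi>(2) f(2) S)
    then have "((\<lambda>s. 1) has_real_derivative
        p u * q u + q u * p u + (f1 u * f2 u + f2 u * f1 u)) (at u)"
      by (rule has_field_derivative_transform_within_open[OF _ S(1,3)]) (rule speed)
    then show ?thesis
      by (rule DERIV_unique) simp
  qed
  \<comment> \<open>The acceleration of a unit-speed profile is orthogonal to its velocity.\<close>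
  then have accel: "p u * q u + f1 u * f2 u = 0"
    by simp

  note inners = e e\<rho>[OF S(4)] e\<rho>1[OF S(4)] e\<rho>2 \<rho>\<rho>[OF S(4)] \<rho>\<rho>1[OF S(4)] \<rho>1\<rho>1[OF S(4)] \<rho>\<rho>2
  have ee: "e \<bullet> e = 1"
    using e by (simp add: dot_square_norm)
  have flip: "\<rho> v \<bullet> e = 0" "\<rho>1 v \<bullet> e = 0" "\<rho>1 v \<bullet> \<rho> v = 0"
    using inners by (simp_all add: inner_commute)
  have g11: "D_u X u v \<bullet> D_u X u v = 1"
    using speed[OF S(3)] by (simp add: Du S inner_simps inners ee flip power2_eq_square)
  have g12: "D_u X u v \<bullet> D_v X u v = 0"
    by (simp add: Du Dv S inner_simps inners)
  have g22: "D_v X u v \<bullet> D_v X u v = (f u)\<^sup>2"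
    by (simp add: Dv S inners power2_eq_square)
  show W: "W_squared X u v = (f u)\<^sup>2"
    by (simp add: W_squared_def g11_def g12_def g22_def g11 g12 g22)

  assume frame: "orthonormal_normal_frame X u v N1 N2"
  have N: "norm N1 = 1" "norm N2 = 1" "N1 \<bullet> N2 = 0"
      "D_u X u v \<bullet> N1 = 0" "D_u X u v \<bullet> N2 = 0" "\<rho>1 v \<bullet> N1 = 0" "\<rho>1 v \<bullet> N2 = 0"
    using frame f_nz S by (auto simp: orthonormal_normal_frame_def Dv inner_commute)
  have "D_u (D_u X) u v \<bullet> D_u X u v = 0" "D_u (D_u X) u v \<bullet> \<rho>1 v = 0"
    using accel by (simp_all add: Du Duu S inner_simps inners ee flip mult.commute)
  moreover have "norm (D_u X u v) = 1"
    using g11 by (simp add: norm_eq_sqrt_inner)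
  \<comment> \<open>\<open>X\<^sub>v\<close> has length \<open>\<bar>f\<bar>\<close>, so \<open>\<rho>1 v\<close> serves as the second unit tangent vector.\<close>
  moreover have "D_u X u v \<bullet> \<rho>1 v = 0"
    using g12 f_nz S by (simp add: Dv)
  ultimately have "L11 X u v N1 * L22 X u v N1 + L11 X u v N2 * L22 X u v N2
      = D_u (D_u X) u v \<bullet> D_v (D_v X) u v"
    unfolding L11_def L22_def
    using N unit[OF S(4)] by (intro inner_normal_components)
  also have "\<dots> = - f u * f2 u"
    by (simp add: Duu Dvv inner_simps inners)
  finally have "L11 X u v N1 * L22 X u v N1 + L11 X u v N2 * L22 X u v N2 = - f u * f2 u" .
  moreover have "L12 X u v N1 = 0" "L12 X u v N2 = 0"
    by (simp_all add: L12_def Duv N)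
  ultimately show "gaussian_curvature X u v N1 N2 = - f2 u / f u"
    using f_nz by (simp add: gaussian_curvature_def W power2_eq_square)
qed

theorem corollary16:
  fixes c l :: real and I J :: "real set"
    and \<phi> :: "real \<Rightarrow> real" and \<rho> :: "real \<Rightarrow> real ^ 4"
  assumes "c \<noteq> 0" and "l > 0"
    and "open I" and "is_interval I"
    and "\<And>u. u \<in> I \<Longrightarrow> cos (u / c) \<noteq> 0"
    and "\<And>u. u \<in> I \<Longrightarrow> 1 - l\<^sup>2 / c\<^sup>2 * (sin (u / c))\<^sup>2 > 0"
    and "\<And>u. u \<in> I \<Longrightarrow>
           (\<phi> has_real_derivative sqrt (1 - l\<^sup>2 / c\<^sup>2 * (sin (u / c))\<^sup>2)) (at u)"
    and "open J" and "is_interval J"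
    and "smooth_curve_on J \<rho>" and "unit_speed_on J \<rho>"
    and "\<And>v. v \<in> J \<Longrightarrow> \<rho> v \<in> sphere 0 1 \<inter> span {axis 2 1, axis 3 1, axis 4 1}"
  shows "let X = generalized_spherical_surface_2 c l \<phi> \<rho> in
         \<forall>u\<in>I. \<forall>v\<in>J. W_squared X u v \<noteq> 0 \<and>
           (\<forall>N1 N2. orthonormal_normal_frame X u v N1 N2 \<longrightarrow>
              gaussian_curvature X u v N1 N2 = 1 / c\<^sup>2)"
proof -
  have \<rho>: "(\<rho> has_vector_derivative vector_derivative \<rho> (at t)) (at t)"
    and \<rho>': "((\<lambda>s. vector_derivative \<rho> (at s)) has_vector_derivative
      vector_derivative (\<lambda>s. vector_derivative \<rho> (at s)) (at t)) (at t)" if "t \<in> J" for t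
  proof -
    have diff: "((\<lambda>g s. vector_derivative g (at s)) ^^ n) \<rho> differentiable at t" for n
      using assms(10) that unfolding smooth_curve_on_def by blast
    show "(\<rho> has_vector_derivative vector_derivative \<rho> (at t)) (at t)"
      using diff[of 0] by (simp flip: vector_derivative_works)
    show "((\<lambda>s. vector_derivative \<rho> (at s)) has_vector_derivative
        vector_derivative (\<lambda>s. vector_derivative \<rho> (at s)) (at t)) (at t)"
      using diff[of 1] by (simp flip: vector_derivative_works)
  qed
  have orth: "axis 1 1 \<bullet> \<rho> t = 0" if "t \<in> J" for t
  proof -
    have "\<rho> t \<in> span {axis 2 1, axis 3 1, axis 4 1}"
      using assms(12)[OF that] by blast
    then have "orthogonal (axis 1 1) (\<rho> t)"
      by (rule orthogonal_to_span) (auto simp: orthogonal_def inner_axis_axis)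
    then show ?thesis
      by (simp add: orthogonal_def)
  qed
  define f where "f = (\<lambda>u. l * cos (u / c))"
  define f1 where "f1 = (\<lambda>u. - (l / c) * sin (u / c))"
  define f2 where "f2 = (\<lambda>u. - (l / c\<^sup>2) * cos (u / c))"
  \<comment> \<open>With this reading of the integrand the unit speed of the profile \<open>(\<phi>, f)\<close> is evident.\<close>
  define p where "p = (\<lambda>u. sqrt (1 - (f1 u)\<^sup>2))"
  have f1_sq: "(f1 u)\<^sup>2 = l\<^sup>2 / c\<^sup>2 * (sin (u / c))\<^sup>2" for u
    by (simp add: f1_def power_mult_distrib power_divide)
  have pos: "1 - (f1 u)\<^sup>2 > 0" if "u \<in> I" for u
    using assms(6)[OF that] by (simp add: f1_sq)
  have speed: "(p u)\<^sup>2 + (f1 u)\<^sup>2 = 1" if "u \<in> I" for u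
    using pos[OF that] by (simp add: p_def)
  have f: "(f has_real_derivative f1 u) (at u)" "(f1 has_real_derivative f2 u) (at u)" for u
    unfolding f_def f1_def f2_def
    using assms(1) by (auto intro!: derivative_eq_intros simp: power2_eq_square)
  \<comment> \<open>No formula for the derivative of \<open>p\<close> is required: the unit-speed relation determines
    \<open>\<phi>''\<close> as far as it enters the curvature.\<close>
  have p: "(p has_real_derivative deriv p u) (at u)" if "u \<in> I" for u
  proof -
    have "((\<lambda>u. 1 - (f1 u)\<^sup>2) has_real_derivative - (2 * f1 u * f2 u)) (at u)"
      by (auto intro!: derivative_eq_intros f(2))
    from DERIV_chain2[OF DERIV_real_sqrt[OF pos[OF that]] this]
    have "p field_differentiable (at u)"
      unfolding p_def field_differentiable_def by blast
    then show ?thesis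
      by (simp add: DERIV_deriv_iff_field_differentiable)
  qed
  let ?X = "generalized_spherical_surface_2 c l \<phi> \<rho>"
  have X: "?X = (\<lambda>u v. \<phi> u *\<^sub>R axis 1 1 + f u *\<^sub>R \<rho> v)"
    by (simp add: generalized_spherical_surface_2_def f_def)
  have "W_squared ?X u v \<noteq> 0 \<and> (\<forall>N1 N2. orthonormal_normal_frame ?X u v N1 N2 \<longrightarrow>
      gaussian_curvature ?X u v N1 N2 = 1 / c\<^sup>2)" if uv: "u \<in> I" "v \<in> J" for u v
  proof -
    have f_nz: "f u \<noteq> 0"
      using assms(2,5) uv by (simp add: f_def)
    have \<phi>: "(\<phi> has_real_derivative p s) (at s)" if "s \<in> I" for s
      using assms(7)[OF that] by (simp add: p_def f1_sq)
    have unit: "norm (\<rho> t) = 1" "norm (vector_derivative \<rho> (at t)) = 1" if "t \<in> J" for t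
      using assms(11) assms(12)[OF that] that by (auto simp: unit_speed_on_def)
    have e: "norm (axis 1 1 :: real ^ 4) = 1"
      by simp
    note curvature = rotational_patch_curvature
      [OF assms(3,8) uv \<phi> p f speed f_nz e orth \<rho> \<rho>' unit, folded X]
    have "- f2 u / f u = 1 / c\<^sup>2"
      using f_nz by (simp add: f_def f2_def)
    then show ?thesis
      using curvature f_nz by simp
  qed
  then show ?thesis
    by (simp add: Let_def)
qed

end
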